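(* Let $X$ and $Y$ be Banach spaces. If $Z=X\oplus_1 Y$ has the Ball Small Combination of Slice Property ($BSCSP$), then either $X$ or $Y$ has $BSCSP$.
   Context: Banach spaces $X,Y$ are real and nontrivial; $B_X$ is the closed unit ball of $X$. $X\oplus_1 Y$ is $X\times Y$ with norm $\|(x,y)\|=\|x\|+\|y\|$. "Either ... or" is inclusive. A slice of $B_X$ is a set $S(B_X,x^*,\alpha)=\{x\in B_X: x^*(x)>\sup x^*(B_X)-\alpha\}$ with $x^*\in X^*$, $\|x^*\|=1$, $\alpha>0$. A convex combination of slices of $B_X$ is a set $\sum_{i=1}^n\lambda_i S_i=\{\sum_{i=1}^n\lambda_i s_i: s_i\in S_i\}$ where each $S_i$ is a slice of $B_X$, $0\le\lambda_i\le 1$ and $\sum_{i=1}^n\lambda_i=1$. $X$ has $BSCSP$ if $B_X$ has convex combinations of slices of arbitrarily small diameter (for every $\varepsilon>0$ there is one of diameter less than $\varepsilon$). *)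

theory Defs
  imports "HOL-Analysis.Analysis"
begin

text \<open>The library norm on products is the Euclidean one, so the sum \<open>X \<oplus>\<^sub>1 Y\<close>
  is a separate copy of the product type, with componentwise operations and the norm
  \<open>\<parallel>x\<parallel> + \<parallel>y\<parallel>\<close>.\<close>

datatype ('a, 'b) l1_sum (infixr \<open>\<oplus>\<^sub>1\<close> 20) = L1_Pair (l1_fst: 'a) (l1_snd: 'b)

instantiation l1_sum :: (real_normed_vector, real_normed_vector) real_normed_vector
begin

definition zero_l1_sum :: "'a \<oplus>\<^sub>1 'b" where
  "0 = L1_Pair 0 0"

definition plus_l1_sum :: "'a \<oplus>\<^sub>1 'b \<Rightarrow> 'a \<oplus>\<^sub>1 'b \<Rightarrow> 'a \<oplus>\<^sub>1 'b" where
  "z + w = L1_Pair (l1_fst z + l1_fst w) (l1_snd z + l1_snd w)"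

definition uminus_l1_sum :: "'a \<oplus>\<^sub>1 'b \<Rightarrow> 'a \<oplus>\<^sub>1 'b" where
  "- z = L1_Pair (- l1_fst z) (- l1_snd z)"

definition minus_l1_sum :: "'a \<oplus>\<^sub>1 'b \<Rightarrow> 'a \<oplus>\<^sub>1 'b \<Rightarrow> 'a \<oplus>\<^sub>1 'b" where
  "z - w = L1_Pair (l1_fst z - l1_fst w) (l1_snd z - l1_snd w)"

definition scaleR_l1_sum :: "real \<Rightarrow> 'a \<oplus>\<^sub>1 'b \<Rightarrow> 'a \<oplus>\<^sub>1 'b" where
  "r *\<^sub>R z = L1_Pair (r *\<^sub>R l1_fst z) (r *\<^sub>R l1_snd z)"

definition norm_l1_sum :: "'a \<oplus>\<^sub>1 'b \<Rightarrow> real" where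
  "norm_l1_sum z = norm (l1_fst z) + norm (l1_snd z)"

definition dist_l1_sum :: "'a \<oplus>\<^sub>1 'b \<Rightarrow> 'a \<oplus>\<^sub>1 'b \<Rightarrow> real" where
  "dist_l1_sum z w = norm (z - w)"

definition sgn_l1_sum :: "'a \<oplus>\<^sub>1 'b \<Rightarrow> 'a \<oplus>\<^sub>1 'b" where
  "sgn_l1_sum z = inverse (norm z) *\<^sub>R z"

definition uniformity_l1_sum_def:
  "(uniformity :: (('a \<oplus>\<^sub>1 'b) \<times> ('a \<oplus>\<^sub>1 'b)) filter) =
    (INF e\<in>{0<..}. principal {(z, w). dist z w < e})"

definition open_l1_sum :: "('a \<oplus>\<^sub>1 'b) set \<Rightarrow> bool" where
  "open_l1_sum U \<longleftrightarrow> (\<forall>z\<in>U. \<forall>\<^sub>F (z', w) in uniformity. z' = z \<longrightarrow> w \<in> U)"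

instance
proof
  fix z w u :: "'a \<oplus>\<^sub>1 'b" and r s :: real
  note defs = zero_l1_sum_def plus_l1_sum_def uminus_l1_sum_def minus_l1_sum_def
    scaleR_l1_sum_def norm_l1_sum_def
  show "z + w + u = z + (w + u)" "z + w = w + z" "0 + z = z" "- z + z = 0" "z - w = z + - w"
    by (simp_all add: defs add_ac)
  show "r *\<^sub>R (z + w) = r *\<^sub>R z + r *\<^sub>R w" "(r + s) *\<^sub>R z = r *\<^sub>R z + s *\<^sub>R z"
    "r *\<^sub>R s *\<^sub>R z = (r * s) *\<^sub>R z" "1 *\<^sub>R z = z"
    by (simp_all add: defs scaleR_add_right scaleR_add_left)
  show "dist z w = norm (z - w)" "sgn z = inverse (norm z) *\<^sub>R z"
    by (simp_all add: dist_l1_sum_def sgn_l1_sum_def)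
  show "uniformity = (INF e\<in>{0<..}. principal {(z, w :: 'a \<oplus>\<^sub>1 'b). dist z w < e})"
    by (fact uniformity_l1_sum_def)
  show "open U \<longleftrightarrow> (\<forall>z\<in>U. \<forall>\<^sub>F (z', w) in uniformity. z' = z \<longrightarrow> w \<in> U)"
    for U :: "('a \<oplus>\<^sub>1 'b) set"
    by (fact open_l1_sum_def)
  show "norm z = 0 \<longleftrightarrow> z = 0"
    by (cases z) (simp add: defs add_nonneg_eq_0_iff)
  show "norm (z + w) \<le> norm z + norm w"
    using norm_triangle_ineq[of "l1_fst z" "l1_fst w"] norm_triangle_ineq[of "l1_snd z" "l1_snd w"]
    by (simp add: defs)
  show "norm (r *\<^sub>R z) = \<bar>r\<bar> * norm z"
    by (simp add: defs distrib_left)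
qed

end

instance l1_sum :: (banach, banach) banach
proof
  fix Z :: "nat \<Rightarrow> 'a \<oplus>\<^sub>1 'b"
  assume Z: "Cauchy Z"
  have dist_eq: "dist z w = dist (l1_fst z) (l1_fst w) + dist (l1_snd z) (l1_snd w)"
    for z w :: "'a \<oplus>\<^sub>1 'b"
    by (simp add: dist_l1_sum_def norm_l1_sum_def minus_l1_sum_def dist_norm)
  have "Cauchy (\<lambda>n. l1_fst (Z n))" "Cauchy (\<lambda>n. l1_snd (Z n))"
    using Z unfolding Cauchy_def dist_eq
    by (meson le_less_trans le_add_same_cancel1 le_add_same_cancel2 zero_le_dist)+
  then obtain x y where x: "(\<lambda>n. l1_fst (Z n)) \<longlonglongrightarrow> x" and y: "(\<lambda>n. l1_snd (Z n)) \<longlonglongrightarrow> y"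
    by (auto simp: Cauchy_convergent_iff convergent_def)
  have "(\<lambda>n. dist (Z n) (L1_Pair x y)) \<longlonglongrightarrow> 0"
    using tendsto_add[OF tendsto_dist[OF x tendsto_const[of x]] tendsto_dist[OF y tendsto_const[of y]]]
    by (simp add: dist_eq)
  then have "Z \<longlonglongrightarrow> L1_Pair x y"
    by (rule tendsto_dist_iff[THEN iffD2])
  then show "convergent Z"
    by (auto simp: convergent_def)
qed

definition slice :: "('a::real_normed_vector \<Rightarrow>\<^sub>L real) \<Rightarrow> real \<Rightarrow> 'a set" where
  "slice f \<alpha> = {x \<in> cball 0 1. f x > (SUP u\<in>cball 0 1. f u) - \<alpha>}"

definition is_slice :: "'a::real_normed_vector set \<Rightarrow> bool" where
  "is_slice S \<longleftrightarrow> (\<exists>f \<alpha>. norm f = 1 \<and> \<alpha> > 0 \<and> S = slice f \<alpha>)"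

definition is_convex_combination_of_slices :: "'a::real_normed_vector set \<Rightarrow> bool" where
  "is_convex_combination_of_slices C \<longleftrightarrow>
    (\<exists>(n::nat) (c::nat \<Rightarrow> real) S.
      (\<forall>i\<in>{1..n}. is_slice (S i) \<and> 0 \<le> c i \<and> c i \<le> 1) \<and> (\<Sum>i=1..n. c i) = 1 \<and>
      C = {\<Sum>i=1..n. c i *\<^sub>R s i | s. \<forall>i\<in>{1..n}. s i \<in> S i})"

text \<open>Convex combinations of slices are nonempty and bounded, so the library's real-valued
  \<^const>\<open>diameter\<close> (which is junk on unbounded sets) is the usual one here. The property
  belongs to a space, hence the type argument.\<close>

definition BSCSP :: "'a::real_normed_vector itself \<Rightarrow> bool" where
  "BSCSP _ \<longleftrightarrow>
    (\<forall>\<epsilon>>0. \<exists>C :: 'a set. is_convex_combination_of_slices C \<and> diameter C < \<epsilon>)"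

end

theory Submission
  imports Defs
begin

text \<open>The dual of \<open>X \<oplus>\<^sub>1 Y\<close> is \<open>X\<^sup>* \<oplus>\<^sub>\<infinity> Y\<^sup>*\<close>, so every norm-one functional on the sum restricts
  to a norm-one functional on one of the two summands (\<open>norm_one_on_summand\<close>). The slice it
  defines then contains a copy of the slice of the same width that the restriction defines in the
  unit ball of that summand (\<open>slice_compose_isometry\<close>).

  Now let \<open>C = \<Sum>i. c\<^sub>i S\<^sub>i\<close> be a convex combination of slices of the ball of \<open>X \<oplus>\<^sub>1 Y\<close>. The slices
  whose functional still has norm one on \<open>X\<close> and those whose functional still has norm one on \<open>Y\<close>
  together exhaust all indices, so one of the two families carries total weight \<open>\<lambda> \<ge> 1/2\<close>. Moving
  only the points of that family, inside the copies of the smaller slices, and freezing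
  all others, shows that \<open>C\<close> contains a translate of \<open>\<lambda> C'\<close>, where \<open>C'\<close> is the convex
  combination of the smaller slices with renormalised weights \<open>c\<^sub>i / \<lambda>\<close>. Hence
  \<open>diam C' \<le> 2 diam C\<close> (\<open>combination_of_slices_in_isometric_subspace\<close>). For every \<open>\<epsilon>\<close> this gives
  a small combination in \<open>X\<close> or in \<open>Y\<close>; if \<open>X\<close> failed for \<open>\<epsilon>\<^sub>1\<close> and \<open>Y\<close> for \<open>\<epsilon>\<^sub>2\<close>, then both
  would fail for \<open>min \<epsilon>\<^sub>1 \<epsilon>\<^sub>2\<close>.\<close>

lemma blinfun_le_norm_on_cball:
  fixes f :: "'a::real_normed_vector \<Rightarrow>\<^sub>L real"
  assumes "u \<in> cball 0 1"
  shows "f u \<le> norm f"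
proof -
  have "f u \<le> norm (f u)" by simp
  also have "\<dots> \<le> norm f * norm u" by (rule norm_blinfun)
  also have "\<dots> \<le> norm f * 1" using assms by (intro mult_left_mono) auto
  finally show ?thesis by simp
qed

lemma bdd_above_blinfun_cball:
  fixes f :: "'a::real_normed_vector \<Rightarrow>\<^sub>L real"
  shows "bdd_above (f ` cball 0 1)"
  by (rule bdd_aboveI2[where M = "norm f"]) (rule blinfun_le_norm_on_cball)

lemma SUP_blinfun_cball:
  fixes f :: "'a::real_normed_vector \<Rightarrow>\<^sub>L real"
  shows "(SUP u\<in>cball 0 1. f u) = norm f"
proof (rule antisym)
  let ?S = "SUP u\<in>cball 0 1. f u"
  show "?S \<le> norm f"
    by (rule cSUP_least) (auto intro: blinfun_le_norm_on_cball)
  have le: "f u \<le> ?S" if "norm u \<le> 1" for u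
    using that by (intro cSUP_upper bdd_above_blinfun_cball) auto
  show "norm f \<le> ?S"
  proof (rule norm_blinfun_bound)
    show "0 \<le> ?S" using le[of 0] by (simp add: blinfun.zero_right)
    fix x
    show "norm (f x) \<le> ?S * norm x"
    proof (cases "x = 0")
      case True then show ?thesis by (simp add: blinfun.zero_right)
    next
      case False
      define v where "v = inverse (norm x) *\<^sub>R x"
      have "norm v \<le> 1" using False by (simp add: v_def)
      then have "\<bar>f v\<bar> \<le> ?S"
        using le[of v] le[of "- v"] by (auto simp: blinfun.minus_right abs_le_iff)
      moreover have "f x = norm x * f v"
        using False by (simp add: v_def blinfun.scaleR_right)
      ultimately show ?thesis
        by (simp add: abs_mult mult.commute mult_left_mono)
    qed
  qed
qed

lemma slice_eq: "slice f \<alpha> = {x \<in> cball 0 1. f x > norm f - \<alpha>}"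
  by (simp add: slice_def SUP_blinfun_cball)

lemma slice_nonempty:
  assumes "0 < \<alpha>"
  shows "slice f \<alpha> \<noteq> {}"
proof -
  have "norm f - \<alpha> < (SUP u\<in>cball 0 1. f u)"
    using assms by (simp add: SUP_blinfun_cball)
  then obtain u where "u \<in> cball 0 1" "norm f - \<alpha> < f u"
    using less_cSUP_iff[OF _ bdd_above_blinfun_cball[of f]] by auto
  then show ?thesis by (auto simp: slice_eq)
qed

lemma slice_compose_isometry:
  fixes T :: "'a::real_normed_vector \<Rightarrow>\<^sub>L 'b::real_normed_vector"
  assumes "\<And>x. norm (T x) = norm x" and "norm (f o\<^sub>L T) = norm f"
    and "x \<in> slice (f o\<^sub>L T) \<alpha>"
  shows "T x \<in> slice f \<alpha>"
  using assms by (auto simp: slice_eq)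

lemma bounded_convex_combination_of_slices:
  assumes "is_convex_combination_of_slices C"
  shows "bounded C"
proof -
  obtain n c S where S: "\<forall>i\<in>{1..n::nat}. is_slice (S i) \<and> 0 \<le> c i \<and> c i \<le> 1"
    and c: "(\<Sum>i=1..n. c i) = 1"
    and C: "C = {\<Sum>i=1..n. c i *\<^sub>R s i | s. \<forall>i\<in>{1..n}. s i \<in> S i}"
    using assms unfolding is_convex_combination_of_slices_def by blast
  have "norm (\<Sum>i=1..n. c i *\<^sub>R s i) \<le> 1" if s: "\<forall>i\<in>{1..n}. s i \<in> S i" for s
  proof -
    have "norm (c i *\<^sub>R s i) \<le> c i" if "i \<in> {1..n}" for i
    proof -
      have "norm (s i) \<le> 1" using s S that by (force simp: is_slice_def slice_def)
      then show ?thesis using S that by (auto intro: mult_left_le)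
    qed
    then have "norm (\<Sum>i=1..n. c i *\<^sub>R s i) \<le> (\<Sum>i=1..n. c i)" by (rule sum_norm_le)
    then show ?thesis unfolding c .
  qed
  then show ?thesis unfolding C bounded_iff by blast
qed

text \<open>With all points outside \<open>I\<close> held fixed, the points \<open>T s\<^sub>i\<close>, \<open>i \<in> I\<close>, still sweep out a
  translate of \<open>\<lambda> C'\<close> inside the given combination, where \<open>\<lambda> = \<Sum>i\<in>I. c\<^sub>i\<close> and \<open>C'\<close> has weights
  \<open>c\<^sub>i / \<lambda>\<close>; since \<open>T\<close> is isometric, \<open>\<lambda> diam C'\<close> is at most the diameter of the combination.\<close>

lemma combination_of_slices_in_isometric_subspace:
  fixes T :: "'a::real_normed_vector \<Rightarrow>\<^sub>L 'b::real_normed_vector"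
  assumes T: "\<And>x. norm (T x) = norm x"
    and f: "\<And>i. i \<in> {1..n} \<Longrightarrow> norm (f i) = 1 \<and> 0 < \<alpha> i \<and> 0 \<le> c i"
    and bdd: "bounded {\<Sum>i=1..n. c i *\<^sub>R s i | s. \<forall>i\<in>{1..n}. s i \<in> slice (f i) (\<alpha> i)}"
    and I: "I \<subseteq> {1..n::nat}" "\<And>i. i \<in> I \<Longrightarrow> norm (f i o\<^sub>L T) = 1"
    and weight: "1/2 \<le> (\<Sum>i\<in>I. c i)"
  shows "\<exists>C' :: 'a set. is_convex_combination_of_slices C' \<and>
    diameter C' \<le> 2 * diameter {\<Sum>i=1..n. c i *\<^sub>R s i | s. \<forall>i\<in>{1..n}. s i \<in> slice (f i) (\<alpha> i)}"
proof -
  define C where "C = {\<Sum>i=1..n. c i *\<^sub>R s i | s. \<forall>i\<in>{1..n}. s i \<in> slice (f i) (\<alpha> i)}"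
  have bC: "bounded C" using bdd by (simp add: C_def)
  define w where "w = (\<Sum>i\<in>I. c i)"
  have w: "1/2 \<le> w" using weight by (simp add: w_def)
  obtain i0 where i0: "i0 \<in> I" using weight by (cases "I = {}") auto
  \<comment> \<open>The index range is kept: an index outside \<open>I\<close> gets weight 0 and some slice from \<open>I\<close>.\<close>
  define k where "k i = (if i \<in> I then i else i0)" for i
  have k: "k i \<in> I" for i using i0 by (simp add: k_def)
  define d where "d i = (if i \<in> I then c i / w else 0)" for i
  define S where "S i = slice (f (k i) o\<^sub>L T) (\<alpha> (k i))" for i
  define C' where "C' = {\<Sum>i=1..n. d i *\<^sub>R s i | s. \<forall>i\<in>{1..n}. s i \<in> S i}"
  have d0: "0 \<le> d i" if "i \<in> {1..n}" for i
    using f[OF that] w by (simp add: d_def)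
  have dI: "(\<Sum>i=1..n. d i) = (\<Sum>i\<in>I. c i / w)"
    unfolding d_def by (rule sum.mono_neutral_cong_right) (use I in auto)
  have d1: "(\<Sum>i=1..n. d i) = 1"
    using w unfolding dI sum_divide_distrib[symmetric] w_def[symmetric] by simp
  have dle: "d i \<le> 1" if "i \<in> {1..n}" for i
    unfolding d1[symmetric] using that d0 by (intro member_le_sum) auto
  have sl: "is_slice (S i)" for i
    unfolding is_slice_def S_def using I(2)[OF k] f k I(1) by blast
  have comb: "is_convex_combination_of_slices C'"
    unfolding is_convex_combination_of_slices_def C'_def
    by (rule exI[of _ n], rule exI[of _ d], rule exI[of _ S]) (simp add: sl d0 dle d1 del: One_nat_def)
  define t where "t i = (SOME x. x \<in> slice (f i) (\<alpha> i))" for i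
  have t: "t i \<in> slice (f i) (\<alpha> i)" if "i \<in> {1..n}" for i
    unfolding t_def using slice_nonempty f[OF that] by (auto simp: some_in_eq)
  define V where "V s = (\<Sum>i=1..n. c i *\<^sub>R (if i \<in> I then T (s i) else t i))" for s
  have V: "V s \<in> C" if s: "\<forall>i\<in>{1..n}. s i \<in> S i" for s
  proof -
    have "(if i \<in> I then T (s i) else t i) \<in> slice (f i) (\<alpha> i)" if i: "i \<in> {1..n}" for i
    proof (cases "i \<in> I")
      case True
      then have "s i \<in> slice (f i o\<^sub>L T) (\<alpha> i)" using bspec[OF s i] by (simp add: S_def k_def)
      then have "T (s i) \<in> slice (f i) (\<alpha> i)"
        using I(2)[OF True] f[OF i] T by (intro slice_compose_isometry) auto
      with True show ?thesis by simp
    qed (use t i in simp)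
    then show ?thesis
      unfolding V_def C_def
      by (intro CollectI exI[of _ "\<lambda>i. if i \<in> I then T (s i) else t i"]) simp
  qed
  have diff: "V s - V s' = T (w *\<^sub>R ((\<Sum>i=1..n. d i *\<^sub>R s i) - (\<Sum>i=1..n. d i *\<^sub>R s' i)))" for s s'
  proof -
    have "V s - V s' = (\<Sum>i=1..n. T (w *\<^sub>R (d i *\<^sub>R s i - d i *\<^sub>R s' i)))"
      unfolding V_def sum_subtractf[symmetric]
      by (rule sum.cong) (use w in \<open>auto simp: d_def blinfun.zero_right blinfun.diff_right
        blinfun.scaleR_right algebra_simps\<close>)
    then show ?thesis
      by (simp add: blinfun.sum_right scaleR_sum_right sum_subtractf scaleR_diff_right
        blinfun.diff_right)
  qed
  have dist: "norm (x - y) \<le> 2 * diameter C" if xy: "x \<in> C'" "y \<in> C'" for x y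
  proof -
    obtain s s' where s: "\<forall>i\<in>{1..n}. s i \<in> S i" "x = (\<Sum>i=1..n. d i *\<^sub>R s i)"
      and s': "\<forall>i\<in>{1..n}. s' i \<in> S i" "y = (\<Sum>i=1..n. d i *\<^sub>R s' i)"
      using xy unfolding C'_def by blast
    have "w * norm (x - y) = norm (V s - V s')"
      using w by (simp add: diff T s s')
    also have "\<dots> \<le> diameter C"
      using diameter_bounded_bound[OF bC V[OF s(1)] V[OF s'(1)]] by (simp add: dist_norm)
    finally have "w * norm (x - y) \<le> diameter C" .
    moreover have "1/2 * norm (x - y) \<le> w * norm (x - y)"
      using w by (intro mult_right_mono) auto
    ultimately show ?thesis by linarith
  qed
  have "diameter C' \<le> 2 * diameter C"
    by (rule diameter_le) (use dist diameter_ge_0[OF bC] in auto)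
  then show ?thesis using comb unfolding C_def by blast
qed

definition l1_inl :: "'a::real_normed_vector \<Rightarrow>\<^sub>L ('a \<oplus>\<^sub>1 'b::real_normed_vector)" where
  "l1_inl = Blinfun (\<lambda>x. L1_Pair x 0)"

definition l1_inr :: "'b::real_normed_vector \<Rightarrow>\<^sub>L ('a::real_normed_vector \<oplus>\<^sub>1 'b)" where
  "l1_inr = Blinfun (\<lambda>y. L1_Pair 0 y)"

lemma l1_inl_apply: "l1_inl x = L1_Pair x 0"
  unfolding l1_inl_def
  by (subst bounded_linear_Blinfun_apply)
    (auto intro!: bounded_linear_intro[where K = 1]
      simp: plus_l1_sum_def scaleR_l1_sum_def norm_l1_sum_def)

lemma l1_inr_apply: "l1_inr y = L1_Pair 0 y"
  unfolding l1_inr_def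
  by (subst bounded_linear_Blinfun_apply)
    (auto intro!: bounded_linear_intro[where K = 1]
      simp: plus_l1_sum_def scaleR_l1_sum_def norm_l1_sum_def)

lemma norm_l1_inl: "norm (l1_inl x) = norm x"
  by (simp add: l1_inl_apply norm_l1_sum_def)

lemma norm_l1_inr: "norm (l1_inr y) = norm y"
  by (simp add: l1_inr_apply norm_l1_sum_def)

lemma norm_compose_isometry_le:
  fixes T :: "'a::real_normed_vector \<Rightarrow>\<^sub>L 'b::real_normed_vector"
  assumes "\<And>x. norm (T x) = norm x"
  shows "norm (f o\<^sub>L T) \<le> norm f"
  by (rule norm_blinfun_bound) (use norm_blinfun[of f "T _"] assms in simp_all)

text \<open>Half of the duality between \<open>\<oplus>\<^sub>1\<close> and \<open>\<oplus>\<^sub>\<infinity>\<close>: \<open>\<bar>f (x, y)\<bar> \<le> a \<parallel>x\<parallel> + b \<parallel>y\<parallel>\<close>, with \<open>a\<close> and \<open>b\<close> the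
  norms of the two restrictions, which is at most \<open>max a b (\<parallel>x\<parallel> + \<parallel>y\<parallel>)\<close>.\<close>

lemma norm_functional_l1_sum_le:
  fixes f :: "('a::real_normed_vector \<oplus>\<^sub>1 'b::real_normed_vector) \<Rightarrow>\<^sub>L real"
  shows "norm f \<le> max (norm (f o\<^sub>L l1_inl)) (norm (f o\<^sub>L l1_inr))" (is "_ \<le> max ?a ?b")
proof (rule norm_blinfun_bound)
  show "0 \<le> max ?a ?b" by (simp add: le_max_iff_disj)
  fix z :: "'a \<oplus>\<^sub>1 'b"
  obtain x y where z: "z = L1_Pair x y" by (cases z)
  then have "z = l1_inl x + l1_inr y"
    by (simp add: l1_inl_apply l1_inr_apply plus_l1_sum_def)
  then have "f z = (f o\<^sub>L l1_inl) x + (f o\<^sub>L l1_inr) y"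
    by (simp add: blinfun.add_right)
  then have "norm (f z) \<le> norm ((f o\<^sub>L l1_inl) x) + norm ((f o\<^sub>L l1_inr) y)"
    using norm_triangle_ineq by metis
  also have "\<dots> \<le> ?a * norm x + ?b * norm y"
    by (intro add_mono norm_blinfun)
  also have "\<dots> \<le> max ?a ?b * norm x + max ?a ?b * norm y"
    by (intro add_mono mult_right_mono) auto
  finally show "norm (f z) \<le> max ?a ?b * norm z"
    by (simp add: z norm_l1_sum_def distrib_left)
qed

lemma norm_one_on_summand:
  fixes f :: "('a::real_normed_vector \<oplus>\<^sub>1 'b::real_normed_vector) \<Rightarrow>\<^sub>L real"
  assumes "norm f = 1"
  shows "norm (f o\<^sub>L l1_inl) = 1 \<or> norm (f o\<^sub>L l1_inr) = 1"
  using norm_functional_l1_sum_le[of f] norm_compose_isometry_le[of l1_inl f, OF norm_l1_inl]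
    norm_compose_isometry_le[of l1_inr f, OF norm_l1_inr] assms
  by linarith

lemma small_combination_of_slices_in_summand:
  fixes C :: "('a::real_normed_vector \<oplus>\<^sub>1 'b::real_normed_vector) set"
  assumes "is_convex_combination_of_slices C"
  shows "(\<exists>A :: 'a set. is_convex_combination_of_slices A \<and> diameter A \<le> 2 * diameter C) \<or>
    (\<exists>B :: 'b set. is_convex_combination_of_slices B \<and> diameter B \<le> 2 * diameter C)"
proof -
  obtain n c S where S: "\<forall>i\<in>{1..n::nat}. is_slice (S i) \<and> 0 \<le> c i \<and> c i \<le> 1"
    and c: "(\<Sum>i=1..n. c i) = 1"
    and C: "C = {\<Sum>i=1..n. c i *\<^sub>R s i | s. \<forall>i\<in>{1..n}. s i \<in> S i}"
    using assms unfolding is_convex_combination_of_slices_def by blast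
  have "\<forall>i\<in>{1..n}. \<exists>f \<alpha>. norm f = 1 \<and> \<alpha> > 0 \<and> S i = slice f \<alpha>"
    using S unfolding is_slice_def by blast
  then obtain f \<alpha> where f: "\<And>i. i \<in> {1..n} \<Longrightarrow> norm (f i) = 1 \<and> \<alpha> i > 0 \<and> S i = slice (f i) (\<alpha> i)"
    by metis
  then have f': "\<And>i. i \<in> {1..n} \<Longrightarrow> norm (f i) = 1 \<and> 0 < \<alpha> i \<and> 0 \<le> c i"
    using S by blast
  have C': "C = {\<Sum>i=1..n. c i *\<^sub>R s i | s. \<forall>i\<in>{1..n}. s i \<in> slice (f i) (\<alpha> i)}"
    using f unfolding C by simp
  have bdd: "bounded {\<Sum>i=1..n. c i *\<^sub>R s i | s. \<forall>i\<in>{1..n}. s i \<in> slice (f i) (\<alpha> i)}"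
    using bounded_convex_combination_of_slices[OF assms] unfolding C' .
  define I where "I = {i \<in> {1..n}. norm (f i o\<^sub>L l1_inl) = 1}"
  have I: "I \<subseteq> {1..n}" "\<And>i. i \<in> I \<Longrightarrow> norm (f i o\<^sub>L l1_inl) = 1"
    by (auto simp: I_def)
  have J: "{1..n} - I \<subseteq> {1..n}" "\<And>i. i \<in> {1..n} - I \<Longrightarrow> norm (f i o\<^sub>L l1_inr) = 1"
    using norm_one_on_summand f by (auto simp: I_def)
  have "(\<Sum>i\<in>I. c i) + (\<Sum>i\<in>{1..n} - I. c i) = 1"
    using sum.subset_diff[OF I(1), of c] c by simp
  then consider "1/2 \<le> (\<Sum>i\<in>I. c i)" | "1/2 \<le> (\<Sum>i\<in>{1..n} - I. c i)" by linarith
  then show ?thesis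
  proof cases
    case 1
    from combination_of_slices_in_isometric_subspace[OF norm_l1_inl f' bdd I 1]
    show ?thesis unfolding C' by blast
  next
    case 2
    from combination_of_slices_in_isometric_subspace[OF norm_l1_inr f' bdd J 2]
    show ?thesis unfolding C' by blast
  qed
qed

theorem proposition2p14:
  assumes "\<exists>x::'a::banach. x \<noteq> 0"
    and "\<exists>y::'b::banach. y \<noteq> 0"
    and "BSCSP TYPE('a \<oplus>\<^sub>1 'b)"
  shows "BSCSP TYPE('a) \<or> BSCSP TYPE('b)"
proof (rule ccontr)
  assume "\<not> ?thesis"
  then obtain \<delta> \<epsilon> where pos: "\<delta> > 0" "\<epsilon> > 0"
    and noA: "\<And>A :: 'a set. is_convex_combination_of_slices A \<Longrightarrow> \<not> diameter A < \<delta>"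
    and noB: "\<And>B :: 'b set. is_convex_combination_of_slices B \<Longrightarrow> \<not> diameter B < \<epsilon>"
    unfolding BSCSP_def by blast
  have "0 < min \<delta> \<epsilon> / 2" using pos by simp
  then obtain C :: "('a \<oplus>\<^sub>1 'b) set"
    where C: "is_convex_combination_of_slices C" "diameter C < min \<delta> \<epsilon> / 2"
    using assms(3) unfolding BSCSP_def by blast
  from small_combination_of_slices_in_summand[OF C(1)] show False
  proof (elim disjE exE conjE)
    fix A :: "'a set"
    assume "is_convex_combination_of_slices A" "diameter A \<le> 2 * diameter C"
    then show False using noA[of A] C(2) by linarith
  next
    fix B :: "'b set"
    assume "is_convex_combination_of_slices B" "diameter B \<le> 2 * diameter C"
    then show False using noB[of B] C(2) by linarith
  qed
qed

end
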